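(* Let $\mathcal{G}$ be an undirected simple graph on $N\ge 1$ vertices with Laplacian matrix $L\in\mathbb{R}^{N\times N}$, and consider the multi-agent system with single-integrator dynamics $\dot x_i = u_i$, $i\in\{1,\dots,N\}$, under the neighbor-based protocol $u_i=\sum_{j\in N_i}(x_j-x_i)$, where $N_i$ is the set of neighbors of $i$ in $\mathcal{G}$. The system is perfectly controllable if and only if all the eigenvalues of $L$ are distinct (each eigenvalue is simple) and, for each eigenvalue of $L$, the corresponding eigenvector has no zero entries.
   Context: The graph $\mathcal{G}$ is undirected, unweighted and without self-loops; agent $i$ corresponds to vertex $i$. Its Laplacian is $L=D-A$, where $A$ is the $0/1$ adjacency matrix and $D$ is the diagonal matrix of vertex degrees. The state $x_i$ of each agent is a real scalar, and the closed-loop system is $\dot x=-Lx$ with $x=(x_1,\dots,x_N)^T$. Leaders and followers: a selection of leaders is a nonempty proper subset $S$ of the vertex set, with $|S|=l$; the remaining $n=N-l$ agents are the followers. After reordering the vertices so that the followers come first and the leaders last, $L$ is partitioned as $$L=\begin{bmatrix} L_f & L_{fl}\\ L_{lf} & L_l\end{bmatrix},$$ where $L_f\in\mathbb{R}^{n\times n}$ corresponds to the followers and $L_l\in\mathbb{R}^{l\times l}$ to the leaders. With $x_f$ and $x_l$ the stacked states of followers and leaders, the followers' dynamics is $$\dot x_f=-L_f x_f-L_{fl}x_l,$$ where $x_l$ is regarded as the control input. The multi-agent system is controllable with leader set $S$ if this linear system is controllable in the usual sense, i.e. the matrix pair $(-L_f,-L_{fl})$ is controllable. Perfectly controllable: the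 multi-agent system is perfectly controllable if it is controllable under every selection of leaders, where both the number and the locations of the leaders are arbitrary. *)

theory Defs
  imports
    Complex_Main
    "Jordan_Normal_Form.Char_Poly"
    "Jordan_Normal_Form.DL_Submatrix"
    "Graph_Theory.Pair_Digraph"
begin

text \<open>
  An undirected simple graph is a \<^term>\<open>pair_graph\<close>: a finite, symmetric, loop-free digraph
  whose arcs are pairs, each undirected edge being a pair of opposite arcs.  The vertices
  (agents) are \<open>0, \<dots>, N - 1\<close>, so the degree of a vertex is its out-degree.
\<close>

definition adjacency_mat :: "nat \<Rightarrow> nat pair_pre_digraph \<Rightarrow> real mat" where
  "adjacency_mat N G = mat N N (\<lambda>(i, j). if (i, j) \<in> parcs G then 1 else 0)"

definition degree_mat :: "nat \<Rightarrow> nat pair_pre_digraph \<Rightarrow> real mat" where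
  "degree_mat N G = mat N N (\<lambda>(i, j). if i = j then real (out_degree (with_proj G) i) else 0)"

definition laplacian :: "nat \<Rightarrow> nat pair_pre_digraph \<Rightarrow> real mat" where
  "laplacian N G = degree_mat N G - adjacency_mat N G"

text \<open>
  A trajectory of \<open>x' = A x + B u\<close> on the time interval \<open>[0, T]\<close>, with continuous input \<open>u\<close>.
  Derivatives are taken entrywise and are one-sided at the end points of the interval.
\<close>

definition trajectory ::
  "real mat \<Rightarrow> real mat \<Rightarrow> real \<Rightarrow> (real \<Rightarrow> real vec) \<Rightarrow> (real \<Rightarrow> real vec) \<Rightarrow> bool" where
  "trajectory A B T u x \<longleftrightarrow>
     (\<forall>t\<in>{0..T}. u t \<in> carrier_vec (dim_col B)) \<and>
     (\<forall>j<dim_col B. continuous_on {0..T} (\<lambda>t. u t $ j)) \<and>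
     (\<forall>t\<in>{0..T}. x t \<in> carrier_vec (dim_row A)) \<and>
     (\<forall>t\<in>{0..T}. \<forall>i<dim_row A.
        ((\<lambda>s. x s $ i) has_real_derivative (A *\<^sub>v x t + B *\<^sub>v u t) $ i) (at t within {0..T}))"

text \<open>
  Controllability of the linear system \<open>x' = A x + B u\<close>: every initial state can be steered to
  every final state in finite time.  It is meant for \<open>A\<close> of size \<open>n \<times> n\<close> and \<open>B\<close> of size
  \<open>n \<times> m\<close>.
\<close>

definition controllable_pair :: "real mat \<Rightarrow> real mat \<Rightarrow> bool" where
  "controllable_pair A B \<longleftrightarrow>
     (\<forall>x0 \<in> carrier_vec (dim_row A). \<forall>x1 \<in> carrier_vec (dim_row A).
        \<exists>T>0. \<exists>u x. trajectory A B T u x \<and> x 0 = x0 \<and> x T = x1)"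

text \<open>
  The blocks of the Laplacian for the leader set \<open>S\<close>.  \<^const>\<open>submatrix\<close> enumerates the selected
  rows and columns in increasing order, so this fixes one of the reorderings that list
  followers first and leaders last.
\<close>

definition L_f :: "nat \<Rightarrow> nat pair_pre_digraph \<Rightarrow> nat set \<Rightarrow> real mat" where
  "L_f N G S = submatrix (laplacian N G) ({0..<N} - S) ({0..<N} - S)"

definition L_fl :: "nat \<Rightarrow> nat pair_pre_digraph \<Rightarrow> nat set \<Rightarrow> real mat" where
  "L_fl N G S = submatrix (laplacian N G) ({0..<N} - S) S"

definition controllable_with_leaders :: "nat \<Rightarrow> nat pair_pre_digraph \<Rightarrow> nat set \<Rightarrow> bool" where
  "controllable_with_leaders N G S \<longleftrightarrow> controllable_pair (- L_f N G S) (- L_fl N G S)"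

definition perfectly_controllable :: "nat \<Rightarrow> nat pair_pre_digraph \<Rightarrow> bool" where
  "perfectly_controllable N G \<longleftrightarrow>
     (\<forall>S. S \<noteq> {} \<and> S \<subset> {0..<N} \<longrightarrow> controllable_with_leaders N G S)"

text \<open>
  The neighbor-based protocol of the agents \<open>x\<^sub>i' = u\<^sub>i\<close>, and the fact that its closed loop is
  \<open>x' = - L x\<close>.
\<close>

definition protocol :: "nat pair_pre_digraph \<Rightarrow> real vec \<Rightarrow> nat \<Rightarrow> real" where
  "protocol G x i = (\<Sum>j | (i, j) \<in> parcs G. x $ j - x $ i)"

lemma laplacian_closed_loop:
  assumes G: "pair_graph G" "pverts G = {0..<N}" and x: "x \<in> carrier_vec N" and i: "i < N"
  shows "(- laplacian N G *\<^sub>v x) $ i = protocol G x i"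
proof -
  interpret pair_graph G by fact
  let ?N = "{j. (i, j) \<in> parcs G}"
  have sub: "?N \<subseteq> {0..<N}" using in_arcsD2 G(2) by auto
  then have fin: "finite ?N" by (rule finite_subset) simp
  have "out_arcs (with_proj G) i = Pair i ` ?N" by (auto simp: out_arcs_def)
  then have deg: "out_degree (with_proj G) i = card ?N"
    by (simp add: out_degree_def card_image inj_on_def)
  have "(- laplacian N G *\<^sub>v x) $ i =
      (\<Sum>j\<in>{0..<N}. (if j \<in> ?N then x $ j else 0)
        - (if i = j then real (card ?N) * x $ j else 0))"
    using i x by (auto simp: laplacian_def degree_mat_def adjacency_mat_def scalar_prod_def
        sum_negf [symmetric] deg left_diff_distrib intro!: sum.cong split: if_splits)
  also have "\<dots> = (\<Sum>j\<in>{0..<N}. if j \<in> ?N then x $ j else 0) - real (card ?N) * x $ i"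
    using i by (simp add: sum_subtractf)
  also have "(\<Sum>j\<in>{0..<N}. if j \<in> ?N then x $ j else 0) = (\<Sum>j\<in>?N. x $ j)"
    using sub by (subst sum.inter_restrict [symmetric]) (auto intro!: sum.cong)
  finally show ?thesis by (simp add: protocol_def sum_subtractf)
qed

end

theory Submission
  imports Defs
begin

text \<open>
  Both sides say that no eigenvector of the Laplacian has a zero entry. For symmetric \<open>A\<close>, the
  pair \<open>(A, B)\<close> is controllable iff no eigenvector of \<open>A\<close> lies in the kernel of \<open>B\<^sup>T\<close> (the Hautus
  test); for the blocks of the Laplacian, such an eigenvector padded by zeros on the leaders is an
  eigenvector of the whole Laplacian, and a single leader suffices to exclude a given zero entry.
  Simplicity of the eigenvalues then comes for free: a multiple eigenvalue of a symmetric matrix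
  has an eigenvector vanishing at vertex \<open>0\<close>.

  Trajectories are built without solving differential equations: a polynomial input is read off
  from a polynomial state, using an annihilating polynomial of \<open>A\<close>.
\<close>

section \<open>Entrywise matrix products and annihilating polynomials\<close>

lemma mult_mat_vec_index:
  assumes "A \<in> carrier_mat n m" "x \<in> carrier_vec m" "i < n"
  shows "(A *\<^sub>v x) $ i = (\<Sum>j<m. A $$ (i, j) * x $ j)"
  using assms by (auto simp: scalar_prod_def atLeast0LessThan)

lemma mult_mat_index:
  assumes "A \<in> carrier_mat n m" "B \<in> carrier_mat m l" "i < n" "j < l"
  shows "(A * B) $$ (i, j) = (\<Sum>k<m. A $$ (i, k) * B $$ (k, j))"
  using assms by (auto simp: scalar_prod_def atLeast0LessThan)

text \<open>The linear functional \<open>X^k \<mapsto> f k\<close> evaluated at \<open>p\<close>.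
  With \<open>f k\<close> an entry of \<open>A^k\<close>, \<open>A^k B\<close> or
  \<open>A^k w\<close>, it is that entry of \<open>p(A)\<close>, \<open>p(A) B\<close> or
  \<open>p(A) w\<close>.\<close>

definition coeff_pairing :: "'a::comm_ring_1 poly \<Rightarrow> (nat \<Rightarrow> 'a) \<Rightarrow> 'a" where
  "coeff_pairing p f = (\<Sum>k\<le>degree p. coeff p k * f k)"

lemma coeff_pairing_eq_sum:
  assumes "degree p < M"
  shows "coeff_pairing p f = (\<Sum>k<M. coeff p k * f k)"
  unfolding coeff_pairing_def
  by (rule sum.mono_neutral_left) (use assms in \<open>auto simp: coeff_eq_0\<close>)

text \<open>Multiplying the polynomial by \<open>X - z\<close> amounts to applying "shift minus
  \<open>z\<close>" to the sequence. This strips a root from \<open>p\<close> while replacing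
  \<open>w\<close> by \<open>A w - z w\<close>.\<close>

lemma coeff_pairing_linear_factor:
  "coeff_pairing ([:- z, 1:] * q) f = coeff_pairing q (\<lambda>k. f (Suc k) - z * f k)"
proof -
  let ?d = "degree q"
  have eq: "[:- z, 1:] * q = pCons 0 q - Polynomial.smult z q" by simp
  have "degree (pCons 0 q - Polynomial.smult z q) < Suc (Suc ?d)"
    using degree_diff_le[of "pCons 0 q" "Suc ?d" "Polynomial.smult z q"] degree_pCons_le[of 0 q]
      degree_smult_le[of z q] by linarith
  then have "coeff_pairing ([:- z, 1:] * q) f
      = (\<Sum>k<Suc (Suc ?d). coeff (pCons 0 q) k * f k) - (\<Sum>k<Suc (Suc ?d). z * coeff q k * f k)"
    by (simp add: eq coeff_pairing_eq_sum sum_subtractf left_diff_distrib del: sum.lessThan_Suc)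
  also have "(\<Sum>k<Suc (Suc ?d). coeff (pCons 0 q) k * f k) = (\<Sum>k<Suc ?d. coeff q k * f (Suc k))"
    by (subst sum.lessThan_Suc_shift) simp
  also have "(\<Sum>k<Suc (Suc ?d). z * coeff q k * f k) = (\<Sum>k<Suc ?d. z * coeff q k * f k)"
    by (simp add: coeff_eq_0)
  also have "(\<Sum>k<Suc ?d. coeff q k * f (Suc k)) - (\<Sum>k<Suc ?d. z * coeff q k * f k)
      = (\<Sum>k<Suc ?d. coeff q k * (f (Suc k) - z * f k))"
    by (simp add: sum_subtractf [symmetric] algebra_simps del: sum.lessThan_Suc)
  also have "\<dots> = coeff_pairing q (\<lambda>k. f (Suc k) - z * f k)"
    by (rule coeff_pairing_eq_sum [symmetric]) simp
  finally show ?thesis .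
qed

text \<open>
  The \<open>n\<^sup>2 + 1\<close> flattened powers of \<open>A\<close> are linearly dependent: written as columns and padded
  with a zero row they form a singular square matrix.
\<close>
lemma annihilating_poly_exists:
  fixes A :: "'a::field mat"
  assumes A: "A \<in> carrier_mat n n"
  shows "\<exists>p. p \<noteq> 0 \<and> (\<forall>i<n. \<forall>j<n. coeff_pairing p (\<lambda>k. (A ^\<^sub>m k) $$ (i, j)) = 0)"
proof -
  let ?M = "Suc (n * n)"
  define F where "F = mat ?M ?M
    (\<lambda>(r, k). if r < n * n then (A ^\<^sub>m k) $$ (r div n, r mod n) else 0)"
  have F: "F \<in> carrier_mat ?M ?M" by (simp add: F_def)
  have "det F = 0"
  proof -
    have "row F (n * n) = 0\<^sub>v ?M" by (intro eq_vecI) (auto simp: F_def)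
    moreover have "F = mat\<^sub>r ?M ?M (\<lambda>i. if i = n * n then 0\<^sub>v ?M else row F i)"
      by (intro eq_matI) (use calculation F in \<open>auto simp: F_def\<close>)
    ultimately show ?thesis
      using det_row_0[of "n * n" ?M "row F"] F by auto
  qed
  then obtain c where c: "c \<in> carrier_vec ?M" "c \<noteq> 0\<^sub>v ?M" "F *\<^sub>v c = 0\<^sub>v ?M"
    using det_0_iff_vec_prod_zero_field[OF F] by auto
  \<comment> \<open>The kernel vector of \<open>F\<close> lists the coefficients of the
    polynomial.\<close>
  define p where "p = (\<Sum>k<?M. monom (c $ k) k)"
  have cp: "coeff p k = (if k < ?M then c $ k else 0)" for k
    unfolding p_def coeff_sum by (auto simp: coeff_monom if_distrib cong: if_cong)
  have "p \<noteq> 0"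
  proof
    assume "p = 0"
    then have "c $ k = 0" if "k < ?M" for k using cp[of k] that by auto
    then have "c = 0\<^sub>v ?M" using c(1) by auto
    then show False using c(2) by simp
  qed
  moreover have "degree p < ?M"
    using \<open>p \<noteq> 0\<close> cp[of "degree p"] by (metis leading_coeff_0_iff)
  moreover have "(\<Sum>k<?M. coeff p k * (A ^\<^sub>m k) $$ (i, j)) = 0" if ij: "i < n" "j < n" for i j
  proof -
    let ?r = "i * n + j"
    have "Suc i * n \<le> n * n" using ij by (intro mult_right_mono) auto
    then have r: "?r < n * n" using ij by simp
    have "(F *\<^sub>v c) $ ?r = (\<Sum>k<?M. F $$ (?r, k) * c $ k)"
      using mult_mat_vec_index[OF F c(1)] r by (simp del: sum.lessThan_Suc)
    also have "\<dots> = (\<Sum>k<?M. coeff p k * (A ^\<^sub>m k) $$ (i, j))"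
      using r ij by (intro sum.cong) (auto simp: F_def cp)
    finally show ?thesis using c(3) r by simp
  qed
  ultimately show ?thesis
    by (intro exI[of _ p]) (simp add: coeff_pairing_eq_sum del: sum.lessThan_Suc)
qed

text \<open>The pairing is linear in the sequence, so row \<open>i\<close> of \<open>p(A) D\<close>
  is row \<open>i\<close> of \<open>p(A)\<close> times \<open>D\<close>. This carries
  \<open>p(A) = 0\<close> over to \<open>A^r B\<close>.\<close>

lemma coeff_pairing_mult_mat:
  assumes A: "\<And>k. A k \<in> carrier_mat n m" and D: "D \<in> carrier_mat m l"
    and "\<And>j. j < m \<Longrightarrow> coeff_pairing p (\<lambda>k. A k $$ (i, j)) = 0" and ij: "i < n" "j < l"
  shows "coeff_pairing p (\<lambda>k. (A k * D) $$ (i, j)) = 0"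
proof -
  have "coeff_pairing p (\<lambda>k. (A k * D) $$ (i, j))
      = (\<Sum>s<m. coeff_pairing p (\<lambda>k. A k $$ (i, s)) * D $$ (s, j))"
    unfolding coeff_pairing_def mult_mat_index[OF A D ij] sum_distrib_left sum_distrib_right
    by (subst sum.swap) (simp add: algebra_simps)
  also have "\<dots> = 0" using assms(3) by simp
  finally show ?thesis .
qed

section \<open>Eigenvectors in the unobservable subspace\<close>

lemma pow_mat_mult_vec_Suc:
  fixes A :: "'a::comm_ring_1 mat"
  assumes A: "A \<in> carrier_mat n n" and w: "w \<in> carrier_vec n"
  shows "A ^\<^sub>m Suc k *\<^sub>v w = A ^\<^sub>m k *\<^sub>v (A *\<^sub>v w)"
  using assoc_mult_mat_vec[of "A ^\<^sub>m k" n n A n w] A w pow_carrier_mat[OF A] by simp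

text \<open>The vectors killed by every \<open>C A^k\<close> form an \<open>A\<close>-invariant
  subspace. A root \<open>z\<close> is split off a polynomial annihilating \<open>w\<close>: either
  \<open>w\<close> is an eigenvector for \<open>z\<close>, or \<open>A w - z w\<close> is a nonzero
  vector of the same subspace, annihilated by the quotient.\<close>

lemma unobservable_eigenvector_complex:
  fixes A :: "complex mat"
  assumes A: "A \<in> carrier_mat n n" and C: "C \<in> carrier_mat l n"
    and w: "w \<in> carrier_vec n" "w \<noteq> 0\<^sub>v n"
    and un: "\<And>k. C *\<^sub>v (A ^\<^sub>m k *\<^sub>v w) = 0\<^sub>v l"
  shows "\<exists>y z. eigenvector A y z \<and> C *\<^sub>v y = 0\<^sub>v l"
proof -
  \<comment> \<open>Only \<open>p(A) w = 0\<close> is assumed here, not \<open>p(A) = 0\<close>: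
    this is what the quotient inherits for the new vector in the induction.\<close>
  have *: "\<exists>y z. eigenvector A y z \<and> C *\<^sub>v y = 0\<^sub>v l"
    if "p \<noteq> 0" "w \<in> carrier_vec n" "w \<noteq> 0\<^sub>v n" "\<And>k. C *\<^sub>v (A ^\<^sub>m k *\<^sub>v w) = 0\<^sub>v l"
      "\<And>i. i < n \<Longrightarrow> coeff_pairing p (\<lambda>k. (A ^\<^sub>m k *\<^sub>v w) $ i) = 0" for p w
    using that
  proof (induction "degree p" arbitrary: p w)
    case 0
    then obtain c where p: "p = [:c:]" "c \<noteq> 0" by (metis degree_eq_zeroE pCons_0_0)
    have "w $ i = 0" if "i < n" for i
      using 0(6)[OF that] p 0(3) A that by (simp add: coeff_pairing_def)
    then have "w = 0\<^sub>v n" using 0(3) by auto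
    with 0(4) show ?case by simp
  next
    case (Suc d)
    then obtain z where "poly p z = 0"
      by (metis constant_degree fundamental_theorem_of_algebra nat.distinct(1))
    then obtain q where p: "p = [:- z, 1:] * q" by (auto simp: poly_eq_0_iff_dvd)
    with \<open>p \<noteq> 0\<close> have q: "q \<noteq> 0" by auto
    have d: "d = degree q" using Suc(2) q unfolding p by (subst (asm) degree_mult_eq) auto
    note w = \<open>w \<in> carrier_vec n\<close>
    define w' where "w' = A *\<^sub>v w - z \<cdot>\<^sub>v w"
    have w'c: "w' \<in> carrier_vec n" using A w by (auto simp: w'_def)
    have pw: "A ^\<^sub>m k *\<^sub>v w' = A ^\<^sub>m Suc k *\<^sub>v w - z \<cdot>\<^sub>v (A ^\<^sub>m k *\<^sub>v w)" for k
      unfolding w'_def pow_mat_mult_vec_Suc[OF A w]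
      using A w pow_carrier_mat[OF A, of k]
      by (simp add: mult_minus_distrib_mat_vec[of _ n n] mult_mat_vec[of _ n n])
    show ?case
    proof (cases "w' = 0\<^sub>v n")
      case True
      have "A *\<^sub>v w = z \<cdot>\<^sub>v w"
      proof (rule eq_vecI)
        fix i assume "i < dim_vec (z \<cdot>\<^sub>v w)"
        then have "i < n" using w by simp
        then show "(A *\<^sub>v w) $ i = (z \<cdot>\<^sub>v w) $ i"
          using w A arg_cong[OF True, of "\<lambda>x. x $ i"] unfolding w'_def by simp
      qed (use A w in auto)
      then have "eigenvector A w z" using w Suc(5) A by (simp add: eigenvector_def)
      moreover have "C *\<^sub>v w = 0\<^sub>v l" using Suc(6)[of 0] A w by simp
      ultimately show ?thesis by blast
    next
      case False
      have "C *\<^sub>v (A ^\<^sub>m k *\<^sub>v w') = 0\<^sub>v l" for k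
      proof -
        have "C *\<^sub>v (A ^\<^sub>m k *\<^sub>v w')
            = C *\<^sub>v (A ^\<^sub>m Suc k *\<^sub>v w) - z \<cdot>\<^sub>v (C *\<^sub>v (A ^\<^sub>m k *\<^sub>v w))"
          unfolding pw
          using C w pow_carrier_mat[OF A, of k] pow_carrier_mat[OF A, of "Suc k"]
          by (simp add: mult_minus_distrib_mat_vec[of _ l n] mult_mat_vec[of _ l n]
              del: pow_mat.simps)
        then show ?thesis unfolding Suc(6) by auto
      qed
      moreover have "coeff_pairing q (\<lambda>k. (A ^\<^sub>m k *\<^sub>v w') $ i) = 0" if "i < n" for i
        using Suc(7)[OF that] that w A pow_carrier_mat[OF A]
        unfolding p coeff_pairing_linear_factor pw by (simp del: pow_mat.simps)
      ultimately show ?thesis using Suc(1)[OF d q w'c False] by blast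
    qed
  qed
  obtain p where p: "p \<noteq> 0"
    "\<And>i j. i < n \<Longrightarrow> j < n \<Longrightarrow> coeff_pairing p (\<lambda>k. (A ^\<^sub>m k) $$ (i, j)) = 0"
    using annihilating_poly_exists[OF A] by blast
  have "coeff_pairing p (\<lambda>k. (A ^\<^sub>m k *\<^sub>v w) $ i) = 0" if i: "i < n" for i
  proof -
    have "coeff_pairing p (\<lambda>k. (A ^\<^sub>m k *\<^sub>v w) $ i)
        = (\<Sum>j<n. coeff_pairing p (\<lambda>k. (A ^\<^sub>m k) $$ (i, j)) * w $ j)"
      unfolding coeff_pairing_def mult_mat_vec_index[OF pow_carrier_mat[OF A] w(1) i]
        sum_distrib_left sum_distrib_right
      by (subst sum.swap) (simp add: algebra_simps)
    then show ?thesis using p(2) i by simp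
  qed
  with * [OF p(1) w un] show ?thesis by blast
qed

lemma map_mat_of_real_pow:
  assumes "A \<in> carrier_mat n n"
  shows "map_mat complex_of_real (A ^\<^sub>m k) = map_mat complex_of_real A ^\<^sub>m k"
  by (rule of_real_hom.mat_hom_pow [OF assms])

lemma scalar_prod_self_pos:
  fixes v :: "real vec"
  assumes v: "v \<in> carrier_vec n" "v \<noteq> 0\<^sub>v n"
  shows "v \<bullet> v > 0"
proof -
  obtain i where i: "i < n" "v $ i \<noteq> 0" using v by force
  have "(\<Sum>i\<in>{0..<n}. v $ i * v $ i) > 0"
    by (rule sum_pos2[of _ i]) (use i in \<open>auto simp: zero_less_mult_iff linorder_neq_iff\<close>)
  then show ?thesis using v by (simp add: scalar_prod_def)
qed

text \<open>A complex eigenvector is split into real and imaginary parts. Symmetry makes its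
  eigenvalue real, so whichever part is nonzero is a real eigenvector in the kernel of
  \<open>C\<close>.\<close>

lemma unobservable_eigenvector_symmetric:
  fixes A :: "real mat"
  assumes A: "A \<in> carrier_mat n n" and sym: "transpose_mat A = A" and C: "C \<in> carrier_mat l n"
    and w: "w \<in> carrier_vec n" "w \<noteq> 0\<^sub>v n"
    and un: "\<And>k. C *\<^sub>v (A ^\<^sub>m k *\<^sub>v w) = 0\<^sub>v l"
  shows "\<exists>y a. eigenvector A y a \<and> C *\<^sub>v y = 0\<^sub>v l"
proof -
  let ?c = "map_mat complex_of_real" and ?v = "map_vec complex_of_real"
  have Ac: "?c A \<in> carrier_mat n n" and Cc: "?c C \<in> carrier_mat l n" using A C by auto
  have wc: "?v w \<in> carrier_vec n" "?v w \<noteq> 0\<^sub>v n"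
    using w of_real_hom.vec_hom_zero_iff[of w n] by auto
  have "?c C *\<^sub>v (?c A ^\<^sub>m k *\<^sub>v ?v w) = 0\<^sub>v l" for k
  proof -
    have "?c C *\<^sub>v (?c A ^\<^sub>m k *\<^sub>v ?v w) = ?v (C *\<^sub>v (A ^\<^sub>m k *\<^sub>v w))"
      using of_real_hom.mult_mat_vec_hom[OF C, of "A ^\<^sub>m k *\<^sub>v w", where 'a = complex]
        of_real_hom.mult_mat_vec_hom[OF pow_carrier_mat[OF A, of k] w(1), where 'a = complex]
        pow_carrier_mat[OF A, of k] w(1)
      by (simp add: map_mat_of_real_pow[OF A])
    then show ?thesis by (simp add: un)
  qed
  from unobservable_eigenvector_complex[OF Ac Cc wc this]
  obtain y z where y: "eigenvector (?c A) y z" "?c C *\<^sub>v y = 0\<^sub>v l" by blast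
  have yc: "y \<in> carrier_vec n" "y \<noteq> 0\<^sub>v n" and yz: "?c A *\<^sub>v y = z \<cdot>\<^sub>v y"
    using y(1) A by (auto simp: eigenvector_def)
  define r s where "r = map_vec Re y" and "s = map_vec Im y"
  have rs: "r \<in> carrier_vec n" "s \<in> carrier_vec n" using yc by (auto simp: r_def s_def)
  have Re: "(M *\<^sub>v r) $ i = Re ((?c M *\<^sub>v y) $ i)" and Im: "(M *\<^sub>v s) $ i = Im ((?c M *\<^sub>v y) $ i)"
    if "M \<in> carrier_mat m n" "i < m" for M m i
    using that yc rs mult_mat_vec_index[of M m n] mult_mat_vec_index[of "?c M" m n y]
    by (auto simp: r_def s_def)
  have Ar: "A *\<^sub>v r = Re z \<cdot>\<^sub>v r - Im z \<cdot>\<^sub>v s"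
    using A yc rs Re[OF A] by (intro eq_vecI) (auto simp: yz r_def s_def)
  have As: "A *\<^sub>v s = Re z \<cdot>\<^sub>v s + Im z \<cdot>\<^sub>v r"
    using A yc rs Im[OF A] by (intro eq_vecI) (auto simp: yz r_def s_def)
  have C0: "C *\<^sub>v r = 0\<^sub>v l" "C *\<^sub>v s = 0\<^sub>v l"
    using C Re[OF C] Im[OF C] by (auto simp: y(2))
  have nz: "r \<noteq> 0\<^sub>v n \<or> s \<noteq> 0\<^sub>v n"
  proof (rule ccontr)
    assume "\<not> ?thesis"
    then have "Re (y $ i) = 0 \<and> Im (y $ i) = 0" if "i < n" for i
      using that yc by (metis index_map_vec(1) index_zero_vec(1) r_def s_def carrier_vecD)
    then have "y = 0\<^sub>v n" using yc by (intro eq_vecI) (auto simp: complex_eq_iff)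
    then show False using yc by simp
  qed
  \<comment> \<open>After inserting \<open>Ar\<close> and \<open>As\<close>, the terms with
    \<open>Re z\<close> cancel.\<close>
  have "s \<bullet> (A *\<^sub>v r) = (A *\<^sub>v s) \<bullet> r"
    using transpose_vec_mult_scalar[OF A rs] sym by simp
  then have "Im z * (r \<bullet> r + s \<bullet> s) = 0"
    using rs unfolding Ar As
    by (simp add: scalar_prod_minus_distrib[of _ n] add_scalar_prod_distrib[of _ n] algebra_simps)
  moreover have "r \<bullet> r + s \<bullet> s > 0"
    using nz rs scalar_prod_self_pos[of r n] scalar_prod_self_pos[of s n]
    by (cases "r = 0\<^sub>v n"; cases "s = 0\<^sub>v n") (auto intro: add_pos_pos)
  ultimately have "Im z = 0" by simp
  then have "A *\<^sub>v r = Re z \<cdot>\<^sub>v r" "A *\<^sub>v s = Re z \<cdot>\<^sub>v s"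
    using rs by (auto simp: Ar As)
  then show ?thesis using nz rs C0 A by (auto simp: eigenvector_def)
qed

section \<open>Spanning by a finite family of columns\<close>

text \<open>The Gram matrix \<open>M M\<^sup>T\<close> is invertible unless some vector annihilates all columns.\<close>
lemma spanning_or_annihilator:
  fixes M :: "nat \<Rightarrow> 'k \<Rightarrow> real"
  assumes "finite K"
    and ann: "\<And>v. v \<in> carrier_vec n \<Longrightarrow> (\<And>k. k \<in> K \<Longrightarrow> (\<Sum>i<n. v $ i * M i k) = 0) \<Longrightarrow> v = 0\<^sub>v n"
  shows "\<exists>c. \<forall>i<n. (x :: real vec) $ i = (\<Sum>k\<in>K. M i k * c k)"
proof -
  define G where "G = mat n n (\<lambda>(i, j). \<Sum>k\<in>K. M i k * M j k)"
  have G: "G \<in> carrier_mat n n" by (simp add: G_def)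
  have Gv: "(G *\<^sub>v v) $ i = (\<Sum>k\<in>K. M i k * (\<Sum>j<n. v $ j * M j k))"
    if "v \<in> carrier_vec n" "i < n" for v i
    using mult_mat_vec_index[OF G that] that
    by (simp add: G_def sum_distrib_right sum_distrib_left sum.swap[of _ "{..<n}" K] mult_ac)
  have "det G \<noteq> 0"
  proof
    assume "det G = 0"
    then obtain v where v: "v \<in> carrier_vec n" "v \<noteq> 0\<^sub>v n" "G *\<^sub>v v = 0\<^sub>v n"
      using det_0_iff_vec_prod_zero_field[OF G] by auto
    \<comment> \<open>The quadratic form of \<open>G\<close> at \<open>v\<close> is a sum of
      squares, so \<open>G v = 0\<close> makes \<open>v\<close> orthogonal to every column.\<close>
    have "(\<Sum>k\<in>K. (\<Sum>i<n. v $ i * M i k)\<^sup>2) = (\<Sum>i<n. v $ i * (G *\<^sub>v v) $ i)"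
      by (simp add: Gv[OF v(1)] power2_eq_square sum_distrib_right sum_distrib_left
          sum.swap[of _ "{..<n}" K] mult_ac)
    also have "\<dots> = 0" by (simp add: v(3))
    finally have "\<forall>k\<in>K. (\<Sum>i<n. v $ i * M i k) = 0"
      using \<open>finite K\<close> by (simp add: sum_nonneg_eq_0_iff)
    then show False using ann v by blast
  qed
  then obtain H where H: "H \<in> carrier_mat n n" "G * H = 1\<^sub>m n"
    using det_non_zero_imp_unit[OF G] by (auto simp: Units_def ring_mat_def)
  \<comment> \<open>\<open>x\<close> carries no dimension, so its first \<open>n\<close> entries are
    collected. With \<open>y = G^-1 x\<close>, the coefficients are the entries of
    \<open>M^T y\<close>.\<close>
  define y where "y = H *\<^sub>v vec n (($) x)"
  have y: "y \<in> carrier_vec n" using H by (simp add: y_def)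
  have "G *\<^sub>v y = vec n (($) x)"
    unfolding y_def using assoc_mult_mat_vec[OF G H(1), of "vec n (($) x)"] H(2) by simp
  then have "x $ i = (\<Sum>k\<in>K. M i k * (\<Sum>j<n. y $ j * M j k))" if "i < n" for i
    using Gv[OF y that] that by simp
  then show ?thesis by (intro exI[of _ "\<lambda>k. \<Sum>j<n. y $ j * M j k"]) simp
qed

section \<open>Derivative chains of polynomials\<close>

text \<open>Member \<open>i\<close> is \<open>z^(i) + b_0 z^(i-1) + ... + b_(i-1) z\<close>. Read as
  \<open>w_i' = w_(i+1) - b_i w_0\<close>, the chain solves a companion-form system whose input is
  its last member.\<close>

fun deriv_chain :: "(nat \<Rightarrow> 'a) \<Rightarrow> nat \<Rightarrow> 'a::{idom,semiring_char_0} poly \<Rightarrow> 'a poly" where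
  "deriv_chain b 0 z = z"
| "deriv_chain b (Suc i) z = pderiv (deriv_chain b i z) + Polynomial.smult (b i) z"

lemma deriv_chain_add:
  "deriv_chain b i (y + z) = deriv_chain b i y + deriv_chain b i z"
  by (induction i) (auto simp: pderiv_add smult_add_right)

text \<open>Each step differentiates once, so a zero of order \<open>r\<close> at \<open>t\<close>
  loses one order per step and its leading coefficient picks up the factors
  \<open>r, r - 1, ...\<close>; \<open>s\<close> absorbs everything of higher order.\<close>

lemma deriv_chain_linear_power:
  assumes "i \<le> r"
  shows "\<exists>s. deriv_chain b i ([:- t, 1:] ^ r * q)
    = [:- t, 1:] ^ (r - i) * (Polynomial.smult (\<Prod>j<i. of_nat (r - j)) q + [:- t, 1:] * s)"
  using assms
proof (induction i)
  case 0
  show ?case by (intro exI[of _ 0]) simp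
next
  case (Suc i)
  let ?c = "\<lambda>i. \<Prod>j<i. of_nat (r - j) :: 'a"
  define X where "X = [:- t, 1:]"
  obtain s where s: "deriv_chain b i (X ^ r * q) = X ^ (r - i) * (Polynomial.smult (?c i) q + X * s)"
    using Suc by (auto simp: X_def)
  define e where "e = r - Suc i"
  have e: "r - i = Suc e" "r = e + Suc i" using Suc.prems by (auto simp: e_def)
  have dX: "pderiv X = 1" by (simp add: X_def pderiv_pCons one_pCons)
  define u where "u = Polynomial.smult (?c i) q + X * s"
  define m where "m = (of_nat (Suc e) :: 'a)"
  have "pderiv (X ^ Suc e * u) = X ^ e * (Polynomial.smult m u + X * pderiv u)"
    unfolding pderiv_mult pderiv_power_Suc dX m_def [symmetric] by (simp add: algebra_simps)
  moreover have "Polynomial.smult m u = Polynomial.smult (?c (Suc i)) q + X * Polynomial.smult m s"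
    by (simp add: u_def m_def smult_add_right e(1) mult_ac)
  \<comment> \<open>The feedback term keeps the full factor \<open>X^r\<close>, with
    \<open>r > e\<close>, and so falls into the remainder.\<close>
  moreover have "Polynomial.smult (b i) (X ^ r * q) = X ^ e * (X * (X ^ i * Polynomial.smult (b i) q))"
    unfolding e(2) power_add by (simp add: mult_ac)
  ultimately have "deriv_chain b (Suc i) (X ^ r * q)
      = X ^ e * (Polynomial.smult (?c (Suc i)) q
          + X * (Polynomial.smult m s + pderiv u + X ^ i * Polynomial.smult (b i) q))"
    unfolding deriv_chain.simps s e(1) u_def [symmetric] by (simp only: distrib_left add.assoc)
  then show ?case unfolding e_def X_def by blast
qed

lemma poly_deriv_chain_linear_power:
  fixes t :: "'a::{idom,semiring_char_0}"
  shows "i < r \<Longrightarrow> poly (deriv_chain b i ([:- t, 1:] ^ r * q)) t = 0"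
    and "poly (deriv_chain b r ([:- t, 1:] ^ r * q)) t = (\<Prod>j<r. of_nat (r - j)) * poly q t"
  using deriv_chain_linear_power[of i r b t q] deriv_chain_linear_power[of r r b t q]
  by auto

text \<open>
  Adding \<open>X\<^sup>r (X - 1)\<^sup>r (c + d X)\<close> to \<open>z\<close> leaves the first \<open>r\<close> members of the chain unchanged
  at \<open>0\<close> and \<open>1\<close> and changes the next one there by arbitrary amounts.
\<close>
lemma deriv_chain_interpolation:
  fixes \<alpha> \<beta> :: "nat \<Rightarrow> real"
  shows "\<exists>z. \<forall>i<r. poly (deriv_chain b i z) 0 = \<alpha> i \<and> poly (deriv_chain b i z) 1 = \<beta> i"
proof (induction r)
  case 0
  show ?case by simp
next
  case (Suc r)
  then obtain z where z: "\<And>i. i < r \<Longrightarrow>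
      poly (deriv_chain b i z) 0 = \<alpha> i \<and> poly (deriv_chain b i z) 1 = \<beta> i" by blast
  define f where "f = (\<Prod>j<r. real (r - j))"
  have f: "f \<noteq> 0" by (auto simp: f_def)
  \<comment> \<open>\<open>f\<close> is \<open>r!\<close>. The cofactor of \<open>X^r\<close> is
    \<open>(-1)^r c\<close> at 0, and that of \<open>(X - 1)^r\<close> is \<open>c + d\<close> at 1;
    \<open>c\<close> and \<open>d\<close> solve for the missing amounts.\<close>
  define c where "c = (\<alpha> r - poly (deriv_chain b r z) 0) / (f * (-1) ^ r)"
  define d where "d = (\<beta> r - poly (deriv_chain b r z) 1) / f - c"
  define y where "y = [:- 0, 1:] ^ r * ([:- 1, 1:] ^ r * [:c, d:])"
  have y': "y = [:- 1, 1:] ^ r * ([:- 0, 1:] ^ r * [:c, d:])"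
    unfolding y_def by (rule mult.left_commute)
  have "poly (deriv_chain b i y) 0 = 0" if "i < r" for i
    unfolding y_def by (rule poly_deriv_chain_linear_power(1)[OF that])
  moreover have "poly (deriv_chain b i y) 1 = 0" if "i < r" for i
    unfolding y' by (rule poly_deriv_chain_linear_power(1)[OF that])
  moreover have "poly (deriv_chain b r y) 0 = f * ((-1) ^ r * c)"
    unfolding y_def poly_deriv_chain_linear_power(2) f_def by simp
  moreover have "poly (deriv_chain b r y) 1 = f * (c + d)"
    unfolding y' poly_deriv_chain_linear_power(2) f_def by simp
  moreover have "f * ((-1) ^ r * c) = \<alpha> r - poly (deriv_chain b r z) 0"
    and "f * (c + d) = \<beta> r - poly (deriv_chain b r z) 1"
    using f by (simp_all add: c_def d_def)
  ultimately have "poly (deriv_chain b i (z + y)) 0 = \<alpha> i \<and> poly (deriv_chain b i (z + y)) 1 = \<beta> i"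
    if "i < Suc r" for i
    using z[of i] that unfolding deriv_chain_add poly_add by (cases "i = r") simp_all
  then show ?case by blast
qed

section \<open>Krylov blocks \<open>A^k B\<close>\<close>

lemma pow_mat_Suc_left:
  assumes A: "A \<in> carrier_mat n n"
  shows "A ^\<^sub>m Suc k = A * A ^\<^sub>m k"
proof (induction k)
  case 0
  show ?case using A by simp
next
  case (Suc k)
  then show ?case
    using assoc_mult_mat[OF A pow_carrier_mat[OF A, of k] A] by simp
qed

lemma transpose_pow_mat:
  fixes A :: "'a::comm_ring_1 mat"
  assumes A: "A \<in> carrier_mat n n" and sym: "transpose_mat A = A"
  shows "transpose_mat (A ^\<^sub>m k) = A ^\<^sub>m k"
proof (induction k)
  case 0
  show ?case by simp
next
  case (Suc k)
  then show ?case
    using transpose_mult[OF pow_carrier_mat[OF A, of k] A] sym pow_mat_Suc_left[OF A, of k] by simp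
qed

context
  fixes A B :: "real mat" and n l :: nat
  assumes A: "A \<in> carrier_mat n n" and B: "B \<in> carrier_mat n l"
begin

lemma krylov_carrier: "A ^\<^sub>m k * B \<in> carrier_mat n l"
  using pow_carrier_mat[OF A, of k] B by auto

lemma krylov_Suc: "A * (A ^\<^sub>m k * B) = A ^\<^sub>m Suc k * B"
  unfolding pow_mat_Suc_left[OF A] by (rule assoc_mult_mat [symmetric, OF A pow_carrier_mat[OF A] B])

lemma krylov_add: "A ^\<^sub>m k * (A ^\<^sub>m r * B) = A ^\<^sub>m (k + r) * B"
proof (induction k arbitrary: r)
  case 0
  show ?case using krylov_carrier[of r] A by simp
next
  case (Suc k)
  have "A ^\<^sub>m Suc k * (A ^\<^sub>m r * B) = A ^\<^sub>m k * (A * (A ^\<^sub>m r * B))"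
    using assoc_mult_mat[OF pow_carrier_mat[OF A, of k] A krylov_carrier[of r]] by simp
  also have "\<dots> = A ^\<^sub>m (k + Suc r) * B" unfolding krylov_Suc by (rule Suc)
  finally show ?case by simp
qed

text \<open>Otherwise some \<open>v \<noteq> 0\<close> is orthogonal to the columns of
  \<open>A^k B\<close> for all \<open>k < degree p\<close>. The recurrence given by \<open>p\<close>
  extends this to all \<open>k\<close>, and an unobservable eigenvector then contradicts
  \<open>hautus\<close>.\<close>

lemma krylov_spanning:
  assumes sym: "transpose_mat A = A"
    and p: "p \<noteq> 0" "\<And>i j. i < n \<Longrightarrow> j < n \<Longrightarrow> coeff_pairing p (\<lambda>k. (A ^\<^sub>m k) $$ (i, j)) = 0"
    and hautus: "\<And>y a. eigenvector A y a \<Longrightarrow> transpose_mat B *\<^sub>v y \<noteq> 0\<^sub>v l"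
  shows "\<exists>c. \<forall>i<n. (x :: real vec) $ i
    = (\<Sum>j<l. \<Sum>k<degree p. (A ^\<^sub>m k * B) $$ (i, j) * c k j)"
proof -
  let ?K = "\<lambda>k. A ^\<^sub>m k * B"
  have ann: "v = 0\<^sub>v n" if v: "v \<in> carrier_vec n"
    and orth: "\<And>kj. kj \<in> {..<l} \<times> {..<degree p} \<Longrightarrow>
      (\<Sum>i<n. v $ i * (case kj of (j, k) \<Rightarrow> ?K k $$ (i, j))) = 0" for v
  proof (rule ccontr)
    assume nz: "v \<noteq> 0\<^sub>v n"
    have g: "(\<Sum>i<n. v $ i * ?K k $$ (i, j)) = 0" if j: "j < l" for k j
    proof (induction k rule: less_induct)
      case (less k)
      show ?case
      proof (cases "k < degree p")
        case True
        then show ?thesis using orth[of "(j, k)"] j by simp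
      next
        case False
        \<comment> \<open>The relation \<open>p(A) A^r B = 0\<close> expresses
          \<open>v^T A^k B\<close> by the same quantity at smaller powers.\<close>
        define r where "r = k - degree p"
        have "coeff_pairing p (\<lambda>k. ?K (k + r) $$ (i, j)) = 0" if "i < n" for i
          using coeff_pairing_mult_mat[OF pow_carrier_mat[OF A] krylov_carrier p(2) that j, of r]
            that by (simp add: krylov_add)
        then have "(\<Sum>i<n. v $ i * coeff_pairing p (\<lambda>k. ?K (k + r) $$ (i, j))) = 0" by simp
        then have "(\<Sum>k\<le>degree p. coeff p k * (\<Sum>i<n. v $ i * ?K (k + r) $$ (i, j))) = 0"
          unfolding coeff_pairing_def sum_distrib_left
          by (subst sum.swap) (simp add: mult_ac)
        moreover have "(\<Sum>k<degree p. coeff p k * (\<Sum>i<n. v $ i * ?K (k + r) $$ (i, j))) = 0"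
          using False less by (intro sum.neutral) (auto simp: r_def)
        ultimately show ?thesis
          using p(1) False by (simp add: lessThan_Suc_atMost [symmetric] r_def)
      qed
    qed
    have "transpose_mat B *\<^sub>v (A ^\<^sub>m k *\<^sub>v v) = 0\<^sub>v l" for k
    proof -
      \<comment> \<open>Symmetry of \<open>A\<close> gives
        \<open>B^T A^k = (A^k B)^T\<close>.\<close>
      have "transpose_mat B *\<^sub>v (A ^\<^sub>m k *\<^sub>v v) = transpose_mat (?K k) *\<^sub>v v"
        using assoc_mult_mat_vec[OF _ pow_carrier_mat[OF A] v, of "transpose_mat B" l k] B
        by (simp add: transpose_mult[OF pow_carrier_mat[OF A] B] transpose_pow_mat[OF A sym])
      also have "\<dots> = 0\<^sub>v l"
      proof (rule eq_vecI)
        fix j assume "j < dim_vec (0\<^sub>v l)"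
        then have j: "j < l" by simp
        have "transpose_mat (?K k) \<in> carrier_mat l n" using krylov_carrier by simp
        from mult_mat_vec_index[OF this v j]
        have "(transpose_mat (?K k) *\<^sub>v v) $ j = (\<Sum>i<n. v $ i * ?K k $$ (i, j))"
          using carrier_matD[OF krylov_carrier[of k]] j by (simp add: mult.commute)
        then show "(transpose_mat (?K k) *\<^sub>v v) $ j = 0\<^sub>v l $ j"
          using g[OF j, of k] j by simp
      qed (use B in simp)
      finally show ?thesis .
    qed
    then show False
      using unobservable_eigenvector_symmetric[OF A sym _ v nz, of "transpose_mat B" l] B hautus
      by auto
  qed
  have "\<exists>c. \<forall>i<n. x $ i = (\<Sum>kj\<in>{..<l} \<times> {..<degree p}. (case kj of (j, k) \<Rightarrow> ?K k $$ (i, j)) * c kj)"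
    by (rule spanning_or_annihilator) (simp, rule ann)
  then obtain c where c: "\<forall>i<n. x $ i = (\<Sum>kj\<in>{..<l} \<times> {..<degree p}.
      (case kj of (j, k) \<Rightarrow> ?K k $$ (i, j)) * c kj)" by (rule exE)
  have "\<forall>i<n. x $ i = (\<Sum>j<l. \<Sum>k<degree p. ?K k $$ (i, j) * c (j, k))"
    using c unfolding sum.cartesian_product by (simp only: case_prod_unfold prod.collapse)
  then show ?thesis by (rule exI[of _ "\<lambda>k j. c (j, k)"])
qed

end

section \<open>The Hautus test for symmetric matrices\<close>

text \<open>The weights \<open>\<kappa>\<close> stand for the entries of \<open>A\<^sup>k B\<close>, which satisfy the linear recurrence
  given by an annihilating polynomial of \<open>A\<close>.\<close>
lemma deriv_chain_telescope:
  fixes z :: "real poly"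
  assumes "p \<noteq> 0" and "coeff_pairing p \<kappa> = 0" and m: "m = degree p"
    and b: "\<And>s. b s = coeff p (m - Suc s) / lead_coeff p"
  shows "(\<Sum>s<m. \<kappa> (m - Suc s) * poly (pderiv (deriv_chain b s z)) t)
    = (\<Sum>s<m. \<kappa> (m - s) * poly (deriv_chain b s z) t) + \<kappa> 0 * poly (deriv_chain b m z) t"
proof -
  let ?w = "\<lambda>s. poly (deriv_chain b s z) t"
  have "lead_coeff p * \<kappa> m + (\<Sum>k<m. coeff p k * \<kappa> k) = 0"
    using assms(2) by (simp add: coeff_pairing_def m lessThan_Suc_atMost [symmetric])
  also have "(\<Sum>k<m. coeff p k * \<kappa> k) = (\<Sum>s<m. coeff p (m - Suc s) * \<kappa> (m - Suc s))"
    by (rule sum.nat_diff_reindex [symmetric])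
  also have "\<dots> = lead_coeff p * (\<Sum>s<m. \<kappa> (m - Suc s) * b s)"
    using \<open>p \<noteq> 0\<close> by (simp add: b sum_distrib_left mult.commute)
  finally have rec: "\<kappa> m = - (\<Sum>s<m. \<kappa> (m - Suc s) * b s)"
    using \<open>p \<noteq> 0\<close> by (simp add: distrib_left [symmetric] add_eq_0_iff)
  have "(\<Sum>s<m. \<kappa> (m - s) * ?w s) + \<kappa> 0 * ?w m = (\<Sum>s<Suc m. \<kappa> (m - s) * ?w s)" by simp
  also have "\<dots> = \<kappa> m * poly z t + (\<Sum>s<m. \<kappa> (m - Suc s) * ?w (Suc s))"
    by (subst sum.lessThan_Suc_shift) simp
  \<comment> \<open>Each \<open>w_(s+1)\<close> is \<open>w_s' + b_s z\<close>; by
    \<open>rec\<close> the \<open>b\<close>-terms cancel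
    \<open>\<kappa> m * poly z t\<close>.\<close>
  also have "\<dots> = \<kappa> m * poly z t + (\<Sum>s<m. \<kappa> (m - Suc s) * b s) * poly z t
      + (\<Sum>s<m. \<kappa> (m - Suc s) * poly (pderiv (deriv_chain b s z)) t)"
    by (simp add: sum_distrib_right sum_distrib_left sum.distrib algebra_simps)
  finally show ?thesis by (simp add: rec)
qed

text \<open>
  With \<open>m\<close> the degree of an annihilating polynomial of \<open>A\<close>, the state \<open>\<Sum>s<m. A\<^sup>m\<^sup>-\<^sup>1\<^sup>-\<^sup>s B w\<^sub>s\<close>
  follows the input \<open>w\<^sub>m\<close> whenever \<open>w\<^sub>0, \<dots>, w\<^sub>m\<close> is a derivative chain; interpolation gives the
  chain any values at the end points.
\<close>
lemma controllable_pair_if_hautus: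
  fixes A B :: "real mat"
  assumes A: "A \<in> carrier_mat n n" and B: "B \<in> carrier_mat n l" and sym: "transpose_mat A = A"
    and hautus: "\<And>y a. eigenvector A y a \<Longrightarrow> transpose_mat B *\<^sub>v y \<noteq> 0\<^sub>v l"
  shows "controllable_pair A B"
  unfolding controllable_pair_def
proof (intro ballI)
  fix x0 x1 :: "real vec"
  assume "x0 \<in> carrier_vec (dim_row A)" "x1 \<in> carrier_vec (dim_row A)"
  then have x01: "x0 \<in> carrier_vec n" "x1 \<in> carrier_vec n" using A by auto
  let ?K = "\<lambda>k. A ^\<^sub>m k * B"
  obtain p where p: "p \<noteq> 0"
    "\<And>i j. i < n \<Longrightarrow> j < n \<Longrightarrow> coeff_pairing p (\<lambda>k. (A ^\<^sub>m k) $$ (i, j)) = 0"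
    using annihilating_poly_exists[OF A] by blast
  define m where "m = degree p"
  define b where "b = (\<lambda>s. coeff p (m - Suc s) / lead_coeff p)"
  have span: "\<exists>c. \<forall>i<n. x $ i = (\<Sum>j<l. \<Sum>k<m. ?K k $$ (i, j) * c k j)" for x :: "real vec"
    unfolding m_def by (rule krylov_spanning[OF A B sym p hautus])
  obtain c0 where c0: "\<forall>i<n. x0 $ i = (\<Sum>j<l. \<Sum>k<m. ?K k $$ (i, j) * c0 k j)"
    using span by blast
  obtain c1 where c1: "\<forall>i<n. x1 $ i = (\<Sum>j<l. \<Sum>k<m. ?K k $$ (i, j) * c1 k j)"
    using span by blast
  \<comment> \<open>One polynomial per input channel. Member \<open>s\<close> multiplies
    \<open>A^(m-1-s) B\<close>, hence the reversed index of the prescribed coefficients.\<close>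
  have "\<forall>j. \<exists>z. \<forall>s<m. poly (deriv_chain b s z) 0 = c0 (m - Suc s) j
      \<and> poly (deriv_chain b s z) 1 = c1 (m - Suc s) j"
    by (intro allI deriv_chain_interpolation)
  then obtain z where z: "\<And>j s. s < m \<Longrightarrow> poly (deriv_chain b s (z j)) 0 = c0 (m - Suc s) j"
      "\<And>j s. s < m \<Longrightarrow> poly (deriv_chain b s (z j)) 1 = c1 (m - Suc s) j"
    by metis
  define x where
    "x = (\<lambda>t. vec n (\<lambda>i. \<Sum>j<l. \<Sum>s<m. ?K (m - Suc s) $$ (i, j) * poly (deriv_chain b s (z j)) t))"
  define u where "u = (\<lambda>t. vec l (\<lambda>j. poly (deriv_chain b m (z j)) t))"
  have "x 0 = x0"
    using x01 c0 sum.nat_diff_reindex[of "\<lambda>k. ?K k $$ (i, j) * c0 k j" m for i j]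
    by (intro eq_vecI) (simp_all add: x_def z)
  moreover have "x 1 = x1"
    using x01 c1 sum.nat_diff_reindex[of "\<lambda>k. ?K k $$ (i, j) * c1 k j" m for i j]
    by (intro eq_vecI) (simp_all add: x_def z)
  moreover have "trajectory A B 1 u x"
    unfolding trajectory_def
  proof (intro conjI ballI allI impI)
    fix t i assume "i < dim_row A"
    then have i: "i < n" using A by simp
    have xt: "x t \<in> carrier_vec n" and ut: "u t \<in> carrier_vec l" by (simp_all add: x_def u_def)
    have "(A *\<^sub>v x t) $ i = (\<Sum>q<n. A $$ (i, q) *
        (\<Sum>j<l. \<Sum>s<m. ?K (m - Suc s) $$ (q, j) * poly (deriv_chain b s (z j)) t))"
      unfolding mult_mat_vec_index[OF A xt i] by (simp add: x_def)
    also have "\<dots> = (\<Sum>j<l. \<Sum>s<m. (\<Sum>q<n. A $$ (i, q) * ?K (m - Suc s) $$ (q, j))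
        * poly (deriv_chain b s (z j)) t)"
      unfolding sum_distrib_left sum_distrib_right
      by (subst sum.swap, rule sum.cong [OF refl], subst sum.swap) (simp add: mult_ac)
    \<comment> \<open>Multiplication by \<open>A\<close> raises each power by one;
      \<open>s < m\<close> keeps the subtraction exact.\<close>
    also have "\<dots> = (\<Sum>j<l. \<Sum>s<m. ?K (m - s) $$ (i, j) * poly (deriv_chain b s (z j)) t)"
    proof (intro sum.cong refl)
      fix j s assume "j \<in> {..<l}" "s \<in> {..<m}"
      then have "(\<Sum>q<n. A $$ (i, q) * ?K (m - Suc s) $$ (q, j)) = ?K (m - s) $$ (i, j)"
        using mult_mat_index[OF A krylov_carrier[OF A B] i, of j "m - Suc s"]
          krylov_Suc[OF A B, of "m - Suc s"] by (simp add: Suc_diff_Suc del: pow_mat.simps)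
      then show "(\<Sum>q<n. A $$ (i, q) * ?K (m - Suc s) $$ (q, j)) * poly (deriv_chain b s (z j)) t
          = ?K (m - s) $$ (i, j) * poly (deriv_chain b s (z j)) t" by simp
    qed
    finally have Ax: "(A *\<^sub>v x t) $ i = \<dots>" .
    have Bu: "(B *\<^sub>v u t) $ i = (\<Sum>j<l. ?K 0 $$ (i, j) * poly (deriv_chain b m (z j)) t)"
      unfolding mult_mat_vec_index[OF B ut i] using A B by (simp add: u_def)
    have "(A *\<^sub>v x t + B *\<^sub>v u t) $ i
        = (\<Sum>j<l. \<Sum>s<m. ?K (m - Suc s) $$ (i, j) * poly (pderiv (deriv_chain b s (z j))) t)"
    proof -
      have "(A *\<^sub>v x t + B *\<^sub>v u t) $ i = (\<Sum>j<l. (\<Sum>s<m. ?K (m - s) $$ (i, j) *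
          poly (deriv_chain b s (z j)) t) + ?K 0 $$ (i, j) * poly (deriv_chain b m (z j)) t)"
        using A B i unfolding sum.distrib Ax [symmetric] Bu [symmetric] by simp
      also have "\<dots> = (\<Sum>j<l. \<Sum>s<m. ?K (m - Suc s) $$ (i, j) *
          poly (pderiv (deriv_chain b s (z j))) t)"
      proof (intro sum.cong refl)
        fix j assume "j \<in> {..<l}"
        then have "coeff_pairing p (\<lambda>k. ?K k $$ (i, j)) = 0"
          using coeff_pairing_mult_mat[OF pow_carrier_mat[OF A] B p(2) i, of j] i by simp
        from deriv_chain_telescope[OF p(1) this m_def, of b "z j" t]
        show "(\<Sum>s<m. ?K (m - s) $$ (i, j) * poly (deriv_chain b s (z j)) t)
            + ?K 0 $$ (i, j) * poly (deriv_chain b m (z j)) t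
          = (\<Sum>s<m. ?K (m - Suc s) $$ (i, j) * poly (pderiv (deriv_chain b s (z j))) t)"
          by (simp add: b_def)
      qed
      finally show ?thesis .
    qed
    moreover have "((\<lambda>t. \<Sum>j<l. \<Sum>s<m. ?K (m - Suc s) $$ (i, j) * poly (deriv_chain b s (z j)) t)
        has_real_derivative
        (\<Sum>j<l. \<Sum>s<m. ?K (m - Suc s) $$ (i, j) * poly (pderiv (deriv_chain b s (z j))) t))
        (at t within {0..1})"
      by (intro DERIV_sum DERIV_cmult has_field_derivative_at_within [OF poly_DERIV])
    ultimately show "((\<lambda>s. x s $ i) has_real_derivative (A *\<^sub>v x t + B *\<^sub>v u t) $ i) (at t within {0..1})"
      using i by (simp only: x_def index_vec)
  qed (use A B in \<open>auto simp: x_def u_def intro!: continuous_intros\<close>)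
  ultimately show "\<exists>T>0. \<exists>u x. trajectory A B T u x \<and> x 0 = x0 \<and> x T = x1"
    by (intro exI[of _ 1]) auto
qed

text \<open>The component of the state along an eigenvector that the input does not see evolves
  autonomously, so it cannot leave \<open>0\<close>.\<close>
lemma hautus_if_controllable_pair:
  fixes A B :: "real mat"
  assumes A: "A \<in> carrier_mat n n" and B: "B \<in> carrier_mat n l" and sym: "transpose_mat A = A"
    and ctrl: "controllable_pair A B" and y: "eigenvector A y a"
  shows "transpose_mat B *\<^sub>v y \<noteq> 0\<^sub>v l"
proof
  assume By: "transpose_mat B *\<^sub>v y = 0\<^sub>v l"
  have yc: "y \<in> carrier_vec n" "y \<noteq> 0\<^sub>v n" and Ay: "A *\<^sub>v y = a \<cdot>\<^sub>v y"
    using y A by (auto simp: eigenvector_def)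
  obtain T u x where T: "T > 0" and traj: "trajectory A B T u x" and x: "x 0 = 0\<^sub>v n" "x T = y"
    using ctrl yc(1) A unfolding controllable_pair_def by (metis carrier_matD(1) zero_carrier_vec)
  have xc: "x t \<in> carrier_vec n" and uc: "u t \<in> carrier_vec l" if "t \<in> {0..T}" for t
    using traj that A B by (auto simp: trajectory_def)
  have dx: "((\<lambda>s. x s $ i) has_real_derivative (A *\<^sub>v x t + B *\<^sub>v u t) $ i) (at t within {0..T})"
    if "t \<in> {0..T}" "i < n" for t i
    using traj that A by (auto simp: trajectory_def)
  define f where "f = (\<lambda>t. \<Sum>i<n. y $ i * x t $ i)"
  have df: "(f has_real_derivative a * f t) (at t within {0..T})" if t: "t \<in> {0..T}" for t
  proof -
    have "(f has_real_derivative (\<Sum>i<n. y $ i * (A *\<^sub>v x t + B *\<^sub>v u t) $ i)) (at t within {0..T})"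
      unfolding f_def using dx[OF t] by (auto intro!: DERIV_sum DERIV_cmult)
    also have "(\<Sum>i<n. y $ i * (A *\<^sub>v x t + B *\<^sub>v u t) $ i) = y \<bullet> (A *\<^sub>v x t + B *\<^sub>v u t)"
      using A B by (simp add: scalar_prod_def atLeast0LessThan)
    also have "\<dots> = y \<bullet> (A *\<^sub>v x t) + y \<bullet> (B *\<^sub>v u t)"
      using A B yc xc[OF t] uc[OF t] by (intro scalar_prod_add_distrib) auto
    also have "y \<bullet> (A *\<^sub>v x t) = (a \<cdot>\<^sub>v y) \<bullet> x t"
      using transpose_vec_mult_scalar[OF A xc[OF t] yc(1)] by (simp add: sym Ay)
    also have "y \<bullet> (B *\<^sub>v u t) = 0"
      using transpose_vec_mult_scalar[OF B uc[OF t] yc(1)] uc[OF t] by (simp add: By)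
    also have "(a \<cdot>\<^sub>v y) \<bullet> x t + 0 = a * f t"
      using xc[OF t] yc by (simp add: f_def scalar_prod_def atLeast0LessThan sum_distrib_left mult.assoc)
    finally show ?thesis .
  qed
  \<comment> \<open>Integrating factor for \<open>f' = a f\<close>: \<open>g\<close> is constant,
    and \<open>g 0 = 0\<close>.\<close>
  define g where "g = (\<lambda>t. exp (- a * t) * f t)"
  have dg: "(g has_real_derivative 0) (at t within {0..T})" if "t \<in> {0..T}" for t
    unfolding g_def by (rule derivative_eq_intros df[OF that] refl | simp)+
  have "continuous_on {0..T} g"
    using dg by (rule DERIV_continuous_on)
  moreover have "DERIV g t :> 0" if "0 < t" "t < T" for t
    using dg[of t] that by (simp add: at_within_Icc_at)
  ultimately have "g T = g 0" using T by (intro DERIV_isconst_end) auto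
  then have "f T = 0" by (simp add: g_def f_def x)
  moreover have "f T = y \<bullet> y" using yc by (simp add: f_def x scalar_prod_def atLeast0LessThan)
  ultimately show False using scalar_prod_self_pos[OF yc] by simp
qed

section \<open>Simple eigenvalues of symmetric matrices\<close>

text \<open>
  Deflation: with an eigenvector \<open>v\<close> normalised to \<open>v\<^sub>0 = 1\<close> as first basis vector, \<open>A\<close> becomes
  block triangular with blocks \<open>k\<close> and \<open>M\<close>. An eigenvector of \<open>M\<close> for \<open>k\<close>, padded by a zero,
  satisfies \<open>A w = k w + c v\<close>, and symmetry forces \<open>c = 0\<close>.
\<close>
lemma symmetric_eigenvalue_simple:
  fixes A :: "real mat"
  assumes A: "A \<in> carrier_mat n n" and sym: "transpose_mat A = A" and "eigenvalue A k"
    and nz: "\<And>v. eigenvector A v k \<Longrightarrow> v $ 0 \<noteq> 0"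
  shows "Polynomial.order k (char_poly A) = 1"
proof -
  obtain v0 where v0: "eigenvector A v0 k" using \<open>eigenvalue A k\<close> by (auto simp: eigenvalue_def)
  then obtain m where n: "n = Suc m"
    using eigenvalue_imp_nonzero_dim[OF A \<open>eigenvalue A k\<close>] by (cases n) auto
  define v where "v = (1 / v0 $ 0) \<cdot>\<^sub>v v0"
  have vc: "v \<in> carrier_vec n" using v0 A by (auto simp: v_def eigenvector_def)
  have v_0: "v $ 0 = 1" using nz[OF v0] v0 A n by (auto simp: v_def eigenvector_def)
  have Av: "A *\<^sub>v v = k \<cdot>\<^sub>v v"
    using v0 A by (auto simp: v_def eigenvector_def mult_mat_vec[of A n n] smult_smult_assoc mult.commute)
  have Av_i: "(\<Sum>j<n. A $$ (i, j) * v $ j) = k * v $ i" if "i < n" for i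
    using mult_mat_vec_index[OF A vc that] Av vc that by simp
  have A_sym: "A $$ (i, j) = A $$ (j, i)" if "i < n" "j < n" for i j
    using that A sym by (metis carrier_matD index_transpose_mat(1))
  define M where "M = mat m m (\<lambda>(i, j). A $$ (Suc i, Suc j) - v $ Suc i * A $$ (0, Suc j))"
  define R where "R = mat 1 m (\<lambda>(i, j). A $$ (0, Suc j))"
  define H where "H = four_block_mat (mat 1 1 (\<lambda>_. k)) R (0\<^sub>m m 1) M"
  \<comment> \<open>The columns of \<open>P\<close> are \<open>v\<close> followed by the unit
    vectors other than the first; \<open>Q\<close> is its inverse, since
    \<open>v $ 0 = 1\<close>.\<close>
  define P where "P = mat n n (\<lambda>(i, j). if j = 0 then v $ i else if i = j then 1 else 0 :: real)"
  define Q where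
    "Q = mat n n (\<lambda>(i, j). if i = j then 1 else if j = 0 then - v $ i else 0 :: real)"
  have H: "H \<in> carrier_mat n n" and P: "P \<in> carrier_mat n n" and Q: "Q \<in> carrier_mat n n"
    by (auto simp: H_def P_def Q_def M_def R_def n)
  have H_index: "H $$ (i, j) = (if i = 0 then if j = 0 then k else A $$ (0, j)
      else if j = 0 then 0 else A $$ (i, j) - v $ i * A $$ (0, j))" if "i < n" "j < n" for i j
    using that by (auto simp: H_def M_def R_def n)
  have split: "(\<Sum>j<n. f j) = f 0 + (\<Sum>j<m. f (Suc j))" for f :: "nat \<Rightarrow> real"
    by (simp add: n sum.lessThan_Suc_shift del: sum.lessThan_Suc)
  have PQ: "P * Q = 1\<^sub>m n"
  proof (rule eq_matI)
    fix i j assume "i < dim_row (1\<^sub>m n :: real mat)" "j < dim_col (1\<^sub>m n :: real mat)"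
    then have ij: "i < n" "j < n" by auto
    have "(P * Q) $$ (i, j) = v $ i * Q $$ (0, j) + (\<Sum>s<m. if i = Suc s then Q $$ (Suc s, j) else 0)"
      unfolding mult_mat_index[OF P Q ij] split
      using ij by (auto simp: P_def n intro!: sum.cong)
    also have "(\<Sum>s<m. if i = Suc s then Q $$ (Suc s, j) else 0) = (if i = 0 then 0 else Q $$ (i, j))"
      using ij n by (cases i) auto
    finally show "(P * Q) $$ (i, j) = 1\<^sub>m n $$ (i, j)"
      using ij v_0 by (auto simp: Q_def)
  qed (use P Q in auto)
  then have QP: "Q * P = 1\<^sub>m n" by (rule mat_mult_left_right_inverse[OF P Q])
  \<comment> \<open>Column 0 of both sides is \<open>A v = k v\<close>; every other column is that
    of \<open>A\<close>, the correction by \<open>v\<close> in \<open>M\<close> being restored by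
    the top row \<open>R\<close>.\<close>
  have "A * P = P * H"
  proof (rule eq_matI)
    fix i j assume "i < dim_row (P * H)" "j < dim_col (P * H)"
    then have ij: "i < n" "j < n" using P H by auto
    have "(P * H) $$ (i, j) = v $ i * H $$ (0, j) + (\<Sum>s<m. if i = Suc s then H $$ (Suc s, j) else 0)"
      unfolding mult_mat_index[OF P H ij] split
      using ij by (auto simp: P_def n intro!: sum.cong)
    also have "(\<Sum>s<m. if i = Suc s then H $$ (Suc s, j) else 0) = (if i = 0 then 0 else H $$ (i, j))"
      using ij n by (cases i) auto
    finally have PH: "(P * H) $$ (i, j) = (if j = 0 then k * v $ i else A $$ (i, j))"
      using ij v_0 by (auto simp: H_index)
    have "(A * P) $$ (i, j) = (\<Sum>s<n. A $$ (i, s) * P $$ (s, j))"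
      by (rule mult_mat_index[OF A P ij])
    also have "\<dots> = (if j = 0 then k * v $ i else A $$ (i, j))"
    proof (cases "j = 0")
      case True
      then show ?thesis using Av_i[OF ij(1)] ij by (simp add: P_def)
    next
      case False
      then have "(\<Sum>s<n. A $$ (i, s) * P $$ (s, j)) = (\<Sum>s<n. if s = j then A $$ (i, s) else 0)"
        using ij by (intro sum.cong) (auto simp: P_def)
      then show ?thesis using ij False by simp
    qed
    finally show "(A * P) $$ (i, j) = (P * H) $$ (i, j)" using PH by simp
  qed (use A P H in auto)
  then have "A = P * H * Q"
    using assoc_mult_mat[OF A P Q] A PQ by (metis right_mult_one_mat)
  then have "similar_mat A H"
    by (intro similar_matI[of A H P Q n]) (use A H P Q PQ QP in auto)
  then have "char_poly A = char_poly (mat 1 1 (\<lambda>_. k)) * char_poly M"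
    using char_poly_similar[of A H] char_poly_four_block_zeros_col[of "mat 1 1 (\<lambda>_. k)" R m M]
    by (simp add: H_def M_def R_def)
  also have "char_poly (mat 1 1 (\<lambda>_. k)) = [:- k, 1:]"
    by (simp add: char_poly_defs det_single)
  finally have cp: "char_poly A = [:- k, 1:] * char_poly M" .
  have M: "M \<in> carrier_mat m m" by (simp add: M_def)
  have "poly (char_poly M) k \<noteq> 0"
  proof
    assume "poly (char_poly M) k = 0"
    then obtain w where w: "eigenvector M w k"
      using eigenvalue_root_char_poly[OF M] by (auto simp: eigenvalue_def)
    have wc: "w \<in> carrier_vec m" "w \<noteq> 0\<^sub>v m" and Mw: "M *\<^sub>v w = k \<cdot>\<^sub>v w"
      using w M by (auto simp: eigenvector_def)
    define y where "y = vec n (\<lambda>i. case i of 0 \<Rightarrow> 0 | Suc i \<Rightarrow> w $ i)"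
    have yc: "y \<in> carrier_vec n" by (simp add: y_def)
    have y_Suc: "y $ Suc i = w $ i" if "i < m" for i using that by (simp add: y_def n)
    have y_0: "y $ 0 = 0" by (simp add: y_def n)
    define c where "c = (\<Sum>j<m. A $$ (0, Suc j) * w $ j)"
    have Ay: "A *\<^sub>v y = k \<cdot>\<^sub>v y + c \<cdot>\<^sub>v v"
    proof (rule eq_vecI)
      fix i assume "i < dim_vec (k \<cdot>\<^sub>v y + c \<cdot>\<^sub>v v)"
      then have i: "i < n" using vc by simp
      have Ayi: "(A *\<^sub>v y) $ i = (\<Sum>j<m. A $$ (i, Suc j) * w $ j)"
        unfolding mult_mat_vec_index[OF A yc i] split by (simp add: y_0 y_Suc)
      show "(A *\<^sub>v y) $ i = (k \<cdot>\<^sub>v y + c \<cdot>\<^sub>v v) $ i"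
      proof (cases i)
        case 0
        then show ?thesis using Ayi i yc vc by (simp add: y_0 v_0 c_def)
      next
        case (Suc s)
        then have s: "s < m" using i n by simp
        have "k * w $ s = (\<Sum>j<m. M $$ (s, j) * w $ j)"
          using mult_mat_vec_index[OF M wc(1) s] Mw wc s by simp
        also have "\<dots> = (\<Sum>j<m. A $$ (i, Suc j) * w $ j) - v $ i * c"
          using s unfolding c_def sum_distrib_left sum_subtractf [symmetric]
          by (intro sum.cong) (auto simp: M_def Suc algebra_simps)
        finally show ?thesis using Ayi i yc vc Suc s by (simp add: y_Suc mult.commute)
      qed
    qed (use A vc in auto)
    \<comment> \<open>Pairing \<open>Ay\<close> with \<open>v\<close> removes \<open>k\<close> from
      both sides and leaves \<open>c * (v \<bullet> v) = 0\<close>.\<close>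
    have "v \<bullet> (A *\<^sub>v y) = (k \<cdot>\<^sub>v v) \<bullet> y"
      using transpose_vec_mult_scalar[OF A yc vc] by (simp add: sym Av)
    then have "c * (v \<bullet> v) = 0"
      using yc vc by (simp add: Ay scalar_prod_add_distrib[of _ n])
    moreover have "v \<noteq> 0\<^sub>v n" using v_0 n by auto
    ultimately have "c = 0" using scalar_prod_self_pos[OF vc] by simp
    then have "A *\<^sub>v y = k \<cdot>\<^sub>v y" using Ay yc vc by auto
    moreover have "y \<noteq> 0\<^sub>v n"
    proof
      assume "y = 0\<^sub>v n"
      then have "w $ i = 0" if "i < m" for i using y_Suc[OF that] that by (simp add: n)
      then have "w = 0\<^sub>v m" using wc by auto
      then show False using wc by simp
    qed
    ultimately have "eigenvector A y k" using yc A by (simp add: eigenvector_def)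
    from nz[OF this] y_0 show False by simp
  qed
  then have M0: "order k (char_poly M) = 0" "char_poly M \<noteq> 0"
    by (auto simp: order_root)
  then have "[:- k, 1:] * char_poly M \<noteq> 0" by (intro no_zero_divisors) auto
  then show ?thesis
    unfolding cp using order_mult[of "[:- k, 1:]" "char_poly M" k] order_power_n_n[of k 1] M0
    by simp
qed

section \<open>The Laplacian and its follower and leader blocks\<close>

lemma transpose_laplacian:
  assumes "pair_graph G"
  shows "transpose_mat (laplacian N G) = laplacian N G"
proof -
  interpret pair_graph G by fact
  have "(i, j) \<in> parcs G \<longleftrightarrow> (j, i) \<in> parcs G" for i j
    by (blast intro: arcs_symmetric)
  then show ?thesis
    by (intro eq_matI) (auto simp: laplacian_def degree_mat_def adjacency_mat_def)
qed

lemma bij_betw_pick: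
  assumes "finite F"
  shows "bij_betw (pick F) {..<card F} F"
  unfolding bij_betw_def
proof
  show "inj_on (pick F) {..<card F}"
    by (rule inj_onI) (metis card_pick_le lessThan_iff)
  show "pick F ` {..<card F} = F"
  proof
    show "pick F ` {..<card F} \<subseteq> F" using pick_in_set_le by auto
    show "F \<subseteq> pick F ` {..<card F}"
    proof
      fix j assume j: "j \<in> F"
      with assms have "card {a \<in> F. a < j} < card F" by (intro psubset_card_mono) auto
      then show "j \<in> pick F ` {..<card F}"
        by (intro image_eqI[where x = "card {a \<in> F. a < j}"]) (simp_all add: pick_card_in_set[OF j])
    qed
  qed
qed

text \<open>The omitted columns meet only zeros of \<open>x\<close>. The case \<open>I = F\<close>
  serves the follower block, \<open>I = S\<close> the leader rows.\<close>

lemma submatrix_mult_vec: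
  fixes A :: "'a::comm_ring_1 mat"
  assumes A: "A \<in> carrier_mat n n" and F: "F \<subseteq> {..<n}" and I: "I \<subseteq> {..<n}"
    and x: "x \<in> carrier_vec n" and zero: "\<And>i. i < n \<Longrightarrow> i \<notin> F \<Longrightarrow> x $ i = 0" and i: "i < card I"
  shows "(submatrix A I F *\<^sub>v vec (card F) (\<lambda>j. x $ pick F j)) $ i = (A *\<^sub>v x) $ pick I i"
proof -
  have "{i. i < n \<and> i \<in> I} = I" "{i. i < n \<and> i \<in> F} = F" using I F by blast+
  then have card: "card {i. i < dim_row A \<and> i \<in> I} = card I" "card {i. i < dim_col A \<and> i \<in> F} = card F"
    using A by (simp_all only: carrier_matD)
  have sub: "submatrix A I F \<in> carrier_mat (card I) (card F)"
    by (rule carrier_matI) (simp_all only: dim_submatrix card)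
  have pI: "pick I i < n" using pick_in_set_le[OF i] I by blast
  have bij: "bij_betw (pick F) {..<card F} F"
    using bij_betw_pick F finite_subset by blast
  have "(submatrix A I F *\<^sub>v vec (card F) (\<lambda>j. x $ pick F j)) $ i
      = (\<Sum>j<card F. A $$ (pick I i, pick F j) * x $ pick F j)"
    by (subst mult_mat_vec_index[OF sub _ i]) (simp_all add: submatrix_index i card)
  also have "\<dots> = (\<Sum>q\<in>F. A $$ (pick I i, q) * x $ q)"
    by (rule sum.reindex_bij_betw[OF bij])
  also have "\<dots> = (\<Sum>q<n. A $$ (pick I i, q) * x $ q)"
    by (rule sum.mono_neutral_left) (use F zero in auto)
  also have "\<dots> = (A *\<^sub>v x) $ pick I i"
    by (rule mult_mat_vec_index[OF A x pI, symmetric])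
  finally show ?thesis .
qed

lemma laplacian_carrier: "laplacian N G \<in> carrier_mat N N"
  by (simp add: laplacian_def degree_mat_def adjacency_mat_def minus_carrier_mat)

text \<open>For \<open>x\<close> vanishing on \<open>S\<close> with follower part \<open>v\<close>,
  the follower rows of \<open>L x = k x\<close> read \<open>L_f v = k v\<close> and the leader rows
  \<open>L_lf v = 0\<close>; by symmetry \<open>L_lf\<close> is the transpose of
  \<open>L_fl\<close>, so this is the Hautus condition.\<close>

lemma controllable_with_leaders_iff:
  assumes G: "pair_graph G" and S: "S \<subseteq> {..<N}"
  shows "controllable_with_leaders N G S \<longleftrightarrow>
    \<not> (\<exists>v k. eigenvector (laplacian N G) v k \<and> (\<forall>i\<in>S. v $ i = 0))"
proof -
  define L where "L = laplacian N G"
  define F where "F = {0..<N} - S"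
  define l where "l = card S"
  define n where "n = card F"
  let ?Lf = "submatrix L F F" and ?Lfl = "submatrix L F S" and ?Llf = "submatrix L S F"
  have L: "L \<in> carrier_mat N N" unfolding L_def by (rule laplacian_carrier)
  have sym: "L $$ (i, j) = L $$ (j, i)" if "i < N" "j < N" for i j
    using that L transpose_laplacian[OF G, of N] by (metis L_def carrier_matD index_transpose_mat(1))
  have F: "F \<subseteq> {..<N}" "F \<union> S = {..<N}" "finite F" using S by (auto simp: F_def)
  have "{i. i < N \<and> i \<in> S} = S" "{i. i < N \<and> i \<in> F} = F" using S F by blast+
  then have card: "card {i. i < dim_row L \<and> i \<in> S} = l" "card {i. i < dim_row L \<and> i \<in> F} = n"
      "card {i. i < dim_col L \<and> i \<in> S} = l" "card {i. i < dim_col L \<and> i \<in> F} = n"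
    using L by (simp_all only: carrier_matD l_def n_def)
  have Lf: "?Lf \<in> carrier_mat n n" and Lfl: "?Lfl \<in> carrier_mat n l" and Llf: "?Llf \<in> carrier_mat l n"
    by (rule carrier_matI, simp_all only: dim_submatrix card)+
  have pF: "pick F i < N" if "i < n" for i
    using pick_in_set_le[of i F] that F(1) unfolding n_def by blast
  have pS: "pick S i < N" if "i < l" for i
    using pick_in_set_le[of i S] that S unfolding l_def by blast
  have Lf_sym: "transpose_mat (- ?Lf) = - ?Lf"
    by (intro eq_matI) (use Lf in \<open>simp_all add: submatrix_index card sym pF\<close>)
  have Lfl_T: "transpose_mat (- ?Lfl) = - ?Llf"
    by (intro eq_matI) (use Lfl Llf in \<open>simp_all add: submatrix_index card sym pF pS\<close>)
  have neg: "- M *\<^sub>v x = - (M *\<^sub>v x)" if "M \<in> carrier_mat r s" "x \<in> carrier_vec s" for M :: "real mat" and r s x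
    using that by (intro uminus_mult_mat_vec) auto
  have pick_F: "\<exists>i<n. p = pick F i" if "p \<in> F" for p
    using bij_betw_pick[OF F(3)] that unfolding bij_betw_def n_def by blast
  have pick_S: "\<exists>i<l. p = pick S i" if "p \<in> S" for p
    using bij_betw_pick[of S] that S finite_subset unfolding bij_betw_def l_def by blast
  have block: "(\<exists>k. eigenvector (- ?Lf) v k \<and> transpose_mat (- ?Lfl) *\<^sub>v v = 0\<^sub>v l)
      \<longleftrightarrow> (\<exists>k. eigenvector L x k)"
    if x: "x \<in> carrier_vec N" and zero: "\<forall>i\<in>S. x $ i = 0" and v: "v = vec n (\<lambda>j. x $ pick F j)" for x v
  proof -
    have zero': "x $ i = 0" if "i < N" "i \<notin> F" for i using zero that F by blast
    have vc: "v \<in> carrier_vec n" by (simp add: v)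
    have f: "(?Lf *\<^sub>v v) $ i = (L *\<^sub>v x) $ pick F i" if "i < n" for i
      unfolding v n_def
      by (rule submatrix_mult_vec[OF L F(1) F(1) x zero']) (use that in \<open>simp_all add: n_def\<close>)
    have g: "(?Llf *\<^sub>v v) $ i = (L *\<^sub>v x) $ pick S i" if "i < l" for i
      unfolding v n_def
      by (rule submatrix_mult_vec[OF L F(1) S x zero']) (use that in \<open>simp_all add: l_def\<close>)
    have nz: "v = 0\<^sub>v n \<longleftrightarrow> x = 0\<^sub>v N"
    proof
      assume "v = 0\<^sub>v n"
      then have "x $ pick F i = 0" if "i < n" for i using that unfolding v by (metis index_vec index_zero_vec(1))
      then have "x $ p = 0" if "p < N" for p using pick_F zero' that by blast
      then show "x = 0\<^sub>v N" using x by (intro eq_vecI) auto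
    next
      assume "x = 0\<^sub>v N"
      then show "v = 0\<^sub>v n" by (intro eq_vecI) (simp_all add: v pF)
    qed
    have eq: "?Lf *\<^sub>v v = k \<cdot>\<^sub>v v \<and> ?Llf *\<^sub>v v = 0\<^sub>v l \<longleftrightarrow> L *\<^sub>v x = k \<cdot>\<^sub>v x" for k
    proof
      assume *: "?Lf *\<^sub>v v = k \<cdot>\<^sub>v v \<and> ?Llf *\<^sub>v v = 0\<^sub>v l"
      have "(L *\<^sub>v x) $ p = k * x $ p" if "p < N" for p
      proof (cases "p \<in> F")
        case True
        then obtain i where i: "i < n" "p = pick F i" using pick_F by blast
        then show ?thesis using f[OF i(1)] * by (simp add: v)
      next
        case False
        then have "p \<in> S" using that F by blast
        then obtain i where i: "i < l" "p = pick S i" using pick_S by blast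
        then show ?thesis using g[OF i(1)] * zero \<open>p \<in> S\<close> by simp
      qed
      then show "L *\<^sub>v x = k \<cdot>\<^sub>v x" using L x by (intro eq_vecI) (simp_all del: index_mult_mat_vec)
    next
      assume *: "L *\<^sub>v x = k \<cdot>\<^sub>v x"
      have "?Lf *\<^sub>v v = k \<cdot>\<^sub>v v"
        using Lf vc f x by (intro eq_vecI) (simp_all add: * v pF del: index_mult_mat_vec)
      moreover have "x $ pick S i = 0" if "i < l" for i
        using zero pick_in_set_le[of i S] that unfolding l_def by blast
      then have "?Llf *\<^sub>v v = 0\<^sub>v l"
        using Llf g x by (intro eq_vecI) (simp_all add: * pS del: index_mult_mat_vec)
      ultimately show "?Lf *\<^sub>v v = k \<cdot>\<^sub>v v \<and> ?Llf *\<^sub>v v = 0\<^sub>v l" ..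
    qed
    have neg_eq: "- u = k \<cdot>\<^sub>v v \<longleftrightarrow> u = (- k) \<cdot>\<^sub>v v" if "u \<in> carrier_vec n" for u k
      using that vc by (auto simp: vec_eq_iff)
    have neg_0: "- u = 0\<^sub>v l \<longleftrightarrow> u = 0\<^sub>v l" if "u \<in> carrier_vec l" for u :: "real vec"
      using that by (auto simp: vec_eq_iff)
    \<comment> \<open>The system matrices are negated blocks, so the eigenvalue changes
      sign.\<close>
    have "eigenvector (- ?Lf) v k \<and> transpose_mat (- ?Lfl) *\<^sub>v v = 0\<^sub>v l \<longleftrightarrow> eigenvector L x (- k)" for k
      using eq[of "- k"] nz vc x Lf Llf L neg_0[of "?Llf *\<^sub>v v"] neg_eq[of "?Lf *\<^sub>v v" k]
      by (simp add: eigenvector_def Lfl_T neg[OF Lf vc] neg[OF Llf vc])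
    then show ?thesis by (metis minus_minus)
  qed
  have "controllable_with_leaders N G S \<longleftrightarrow>
      \<not> (\<exists>v k. eigenvector (- ?Lf) v k \<and> transpose_mat (- ?Lfl) *\<^sub>v v = 0\<^sub>v l)"
    using controllable_pair_if_hautus[of "- ?Lf" n "- ?Lfl" l]
      hautus_if_controllable_pair[of "- ?Lf" n "- ?Lfl" l] Lf Lfl Lf_sym
    unfolding controllable_with_leaders_def L_f_def L_fl_def L_def [symmetric] F_def [symmetric]
    by (metis uminus_carrier_iff_mat)
  also have "(\<exists>v k. eigenvector (- ?Lf) v k \<and> transpose_mat (- ?Lfl) *\<^sub>v v = 0\<^sub>v l)
      \<longleftrightarrow> (\<exists>x k. eigenvector L x k \<and> (\<forall>i\<in>S. x $ i = 0))"
  proof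
    assume "\<exists>v k. eigenvector (- ?Lf) v k \<and> transpose_mat (- ?Lfl) *\<^sub>v v = 0\<^sub>v l"
    then obtain v k where v: "eigenvector (- ?Lf) v k" "transpose_mat (- ?Lfl) *\<^sub>v v = 0\<^sub>v l" by blast
    then have vc: "v \<in> carrier_vec n" using Lf by (auto simp: eigenvector_def)
    \<comment> \<open>The number of followers below \<open>p\<close> is the position of
      \<open>p\<close> in the enumeration, inverting \<open>pick F\<close>.\<close>
    define x where "x = vec N (\<lambda>p. if p \<in> S then 0 else v $ card {a \<in> F. a < p})"
    have "pick F j \<notin> S" if "j < n" for j
      using pick_in_set_le[of j F] that unfolding n_def F_def by blast
    then have "v = vec n (\<lambda>j. x $ pick F j)"
      using vc by (intro eq_vecI) (simp_all add: x_def pF card_pick_le n_def)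
    moreover have "x \<in> carrier_vec N" "\<forall>i\<in>S. x $ i = 0" using S by (auto simp: x_def)
    ultimately show "\<exists>x k. eigenvector L x k \<and> (\<forall>i\<in>S. x $ i = 0)" using block[of x v] v by blast
  next
    assume "\<exists>x k. eigenvector L x k \<and> (\<forall>i\<in>S. x $ i = 0)"
    then obtain x k where x: "eigenvector L x k" "\<forall>i\<in>S. x $ i = 0" by blast
    then have "x \<in> carrier_vec N" using L by (auto simp: eigenvector_def)
    from block[OF this x(2) refl] x(1)
    show "\<exists>v k. eigenvector (- ?Lf) v k \<and> transpose_mat (- ?Lfl) *\<^sub>v v = 0\<^sub>v l" by blast
  qed
  finally show ?thesis by (simp only: L_def)
qed

section \<open>Perfect controllability and the Laplacian spectrum\<close>

theorem theorem1:
  fixes N :: nat and G :: "nat pair_pre_digraph"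
  assumes "N \<ge> 1" and "pair_graph G" and "pverts G = {0..<N}"
  shows "perfectly_controllable N G \<longleftrightarrow>
    (\<forall>k. eigenvalue (laplacian N G) k \<longrightarrow> Polynomial.order k (char_poly (laplacian N G)) = 1) \<and>
    (\<forall>k v. eigenvector (laplacian N G) v k \<longrightarrow> (\<forall>i<N. v $ i \<noteq> 0))"
proof -
  let ?L = "laplacian N G"
  let ?nz = "\<forall>k v. eigenvector ?L v k \<longrightarrow> (\<forall>i<N. v $ i \<noteq> 0)"
  have ctrl: "controllable_with_leaders N G S \<longleftrightarrow>
      \<not> (\<exists>v k. eigenvector ?L v k \<and> (\<forall>i\<in>S. v $ i = 0))" if "S \<subset> {0..<N}" for S
    by (rule controllable_with_leaders_iff[OF assms(2)]) (use that in auto)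
  have "perfectly_controllable N G \<longleftrightarrow> ?nz"
  proof
    assume pc: "perfectly_controllable N G"
    show ?nz
    proof (intro allI impI notI)
      fix k v i assume v: "eigenvector ?L v k" and i: "i < N" "v $ i = 0"
      \<comment> \<open>A leader set must be proper. If \<open>i\<close> were the only vertex,
        \<open>v\<close> would be the zero vector.\<close>
      have "{i} \<noteq> {0..<N}"
      proof
        assume "{i} = {0..<N}"
        then have "v = 0\<^sub>v N"
          using v i laplacian_carrier[of N G] by (intro eq_vecI) (auto simp: eigenvector_def)
        then show False using v laplacian_carrier[of N G] by (simp add: eigenvector_def)
      qed
      then have "{i} \<subset> {0..<N}" using i by auto
      then show False
        using pc ctrl[of "{i}"] v i(2) unfolding perfectly_controllable_def by blast
    qed
  next
    assume nz: ?nz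
    show "perfectly_controllable N G"
      unfolding perfectly_controllable_def
    proof (intro allI impI)
      fix S assume S: "S \<noteq> {} \<and> S \<subset> {0..<N}"
      then obtain i where "i \<in> S" "i < N" by fastforce
      then show "controllable_with_leaders N G S" using S ctrl[of S] nz by blast
    qed
  qed
  \<comment> \<open>\<open>N \<ge> 1\<close> makes 0 a vertex, so no eigenvector vanishes there and
    the deflation lemma applies.\<close>
  moreover have "Polynomial.order k (char_poly ?L) = 1" if "eigenvalue ?L k" and nz: ?nz for k
  proof (rule symmetric_eigenvalue_simple[OF laplacian_carrier transpose_laplacian[OF assms(2)] that(1)])
    fix v assume "eigenvector ?L v k"
    moreover have "0 < N" using assms(1) by simp
    ultimately show "v $ 0 \<noteq> 0" using nz by blast
  qed
  then have "?nz \<longrightarrow> (\<forall>k. eigenvalue ?L k \<longrightarrow> Polynomial.order k (char_poly ?L) = 1)"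
    by (intro impI allI)
  ultimately show ?thesis by argo
qed

end
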